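(* Let $r\ge0$ and let $$c_n(z,D_{\mathrm{tr}},x_0)=\sup\{\mathrm E^n_D[L(z,y)\mid x=x_0]:\ D\in\mathcal D_n,\ B(D,D_{\mathrm{tr}})\le r\},\qquad z^r\in\arg\min_z c_n(z,D_{\mathrm{tr}},x_0),$$ be the robust Nadaraya-Watson formulation (number of neighbors $k(n)=n$) with bootstrap distance function $B$ and robustness radius $r$. Its bootstrap disappointment is at most $b(n)=\exp(-n\cdot r)$; that is, $$D_{\mathrm{tr}}^\infty\left[\mathrm E^n_{D_{\mathrm{bs}[n]}}[L(z^r,y)\mid x=x_0]>c_n(z^r,D_{\mathrm{tr}},x_0)\right]\le\exp(-n\cdot r).$$
   Context: Data. Let $\bar d_1=(\bar x_1,\bar y_1),\dots,\bar d_n=(\bar x_n,\bar y_n)$ be a fixed finite list (training data, $n\ge1$) of points in $\Omega\subseteq\mathbb R^{\dim(x)}\times\mathbb R^{\dim(y)}$, $\Omega_n$ the finite set of distinct points in the list, $\mathcal D_n$ the set of all probability distributions on $\Omega_n$, and $D_{\mathrm{tr}}=\frac1n\sum_{i=1}^n\delta_{\bar d_i}$. Fix a context of interest $x_0\in\mathbb R^{\dim(x)}$. $w_n(\bar x,x_0)>0$ is a positive weighing function. $L(z,\bar y)\in\mathbb R_+\cup\{+\infty\}$ is convex in the decision $z\in\mathbb R^{\dim(z)}$ for each $\bar y$ and measurable in $\bar y$ for each $z$. Convention: $0\cdot(+\infty)=0$. Nadaraya-Watson estimator (the case $k(n)=n$, all observations are used): for $D\in\mathcal D_n$, $$\mathrm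 E^n_D[L(z,y)\mid x=x_0]=\frac{\sum_{(\bar x,\bar y)\in\Omega_n}L(z,\bar y)\,w_n(\bar x,x_0)\,D[\bar x,\bar y]}{\sum_{(\bar x,\bar y)\in\Omega_n}w_n(\bar x,x_0)\,D[\bar x,\bar y]}.$$ Bootstrap distance. $B(D,D')=\sum_{(\bar x,\bar y)\in\Omega_n}D[\bar x,\bar y]\log\left(D[\bar x,\bar y]/D'[\bar x,\bar y]\right)$ for $D,D'\in\mathcal D_n$ (relative entropy, usual conventions $0\log0=0$, value $+\infty$ if $D\not\ll D'$). Bootstrap. $D_{\mathrm{tr}}^\infty$ is the law of an i.i.d. sequence with marginal $D_{\mathrm{tr}}$ (resampling with replacement from the training data), and $D_{\mathrm{bs}[n]}$ is the empirical distribution of the first $n$ terms of that sequence. *)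

theory Defs
  imports "HOL-Probability.Probability"
begin

text \<open>
  Observations are pairs (covariate, outcome). Throughout, \<open>S\<close> is the finite set of distinct
  training points, and \<open>w x x0\<close> is the weight of an observation with covariate \<open>x\<close> in the
  context \<open>x0\<close>, the sample size being fixed. The loss takes its values in \<open>ennreal\<close>, where
  \<open>0 * \<infinity> = 0\<close>.
\<close>

definition dists_on :: "'a set \<Rightarrow> 'a pmf set" where
  "dists_on S = {D. set_pmf D \<subseteq> S}"

text \<open>For a nonempty list, this is the average of the point masses at its entries, counted with
  multiplicity.\<close>

definition empirical_pmf :: "'a list \<Rightarrow> 'a pmf" where
  "empirical_pmf xs = pmf_of_multiset (mset xs)"

definition nadaraya_watson ::
  "('x \<times> 'y) set \<Rightarrow> ('x \<Rightarrow> 'x \<Rightarrow> real) \<Rightarrow> ('z \<Rightarrow> 'y \<Rightarrow> ennreal) \<Rightarrow> 'x \<Rightarrow> ('x \<times> 'y) pmf \<Rightarrow> 'z \<Rightarrow> ennreal"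
where
  "nadaraya_watson S w L x0 D z =
     (\<Sum>(x, y)\<in>S. L z y * ennreal (w x x0) * ennreal (pmf D (x, y))) /
     (\<Sum>(x, y)\<in>S. ennreal (w x x0) * ennreal (pmf D (x, y)))"

text \<open>Extended-real valued, unlike \<open>KL_divergence\<close> of the library, which is real valued and so
  does not yield \<open>\<infinity>\<close> when absolute continuity fails.\<close>

definition bootstrap_dist :: "'a set \<Rightarrow> 'a pmf \<Rightarrow> 'a pmf \<Rightarrow> ereal" where
  "bootstrap_dist S D D' =
     (\<Sum>p\<in>S. if pmf D p = 0 then 0
             else if pmf D' p = 0 then \<infinity>
             else ereal (pmf D p * ln (pmf D p / pmf D' p)))"

definition robust_nadaraya_watson ::
  "('x \<times> 'y) set \<Rightarrow> ('x \<Rightarrow> 'x \<Rightarrow> real) \<Rightarrow> ('z \<Rightarrow> 'y \<Rightarrow> ennreal) \<Rightarrow> real \<Rightarrow> 'x \<Rightarrow> ('x \<times> 'y) pmf \<Rightarrow> 'z \<Rightarrow> ennreal"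
where
  "robust_nadaraya_watson S w L r x0 D' z =
     (SUP D \<in> {D \<in> dists_on S. bootstrap_dist S D D' \<le> ereal r}. nadaraya_watson S w L x0 D z)"

definition convex_ennreal :: "('a::real_vector \<Rightarrow> ennreal) \<Rightarrow> bool" where
  "convex_ennreal f \<longleftrightarrow>
     (\<forall>z1 z2 u v. 0 \<le> u \<and> 0 \<le> v \<and> u + v = 1 \<longrightarrow>
        f (u *\<^sub>R z1 + v *\<^sub>R z2) \<le> ennreal u * f z1 + ennreal v * f z2)"

end

theory Submission
  imports Defs
begin

text \<open>
  The bound has no polynomial prefactor, so it does not come from counting the possible empirical
  distributions. It comes from the convexity of the disappointment event, by a change of measure.

  Let \<open>P\<close> be the training distribution, \<open>A\<close> a set of samples of size \<open>n\<close> with positive probability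
  under \<open>P\<^sup>n\<close>, and let \<open>D\<close> be the mean of the empirical distribution of a sample that is
  conditioned to lie in \<open>A\<close>. Write \<open>KL\<close> for the relative entropy of \<open>D\<close> with respect to \<open>P\<close>.
  The likelihood ratio of \<open>D\<^sup>n\<close> to \<open>P\<^sup>n\<close> is the exponential of a sum over the sample, whose mean
  given \<open>A\<close> is exactly \<open>n * KL\<close>. Jensen's inequality then gives
  \<open>1 \<ge> D\<^sup>n(A) \<ge> P\<^sup>n(A) * exp (n * KL)\<close>; this is \<open>prob_replicate_pmf_le_exp_KL\<close>.

  Now let \<open>A\<close> be the set of samples whose estimate exceeds the robust value \<open>c\<close>. If \<open>c\<close> is infinite,
  then \<open>A\<close> is empty. Otherwise the loss is finite at every training point, because \<open>P\<close> itself is one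
  of the distributions over which the supremum is taken. The estimate is a ratio of two linear
  functions of the distribution, with positive denominator, so it exceeds \<open>c\<close> exactly on an open
  half-space, and this half-space contains the average \<open>D\<close> of its members
  (\<open>less_nadaraya_watson_bind_pmf\<close>). An estimate above the supremum puts \<open>D\<close> outside the ball of
  radius \<open>r\<close>, so \<open>KL > r\<close> and the probability of \<open>A\<close> is at most \<open>exp (- n * r)\<close>.

  The decision \<open>zr\<close> and the robust value are computed from the training data alone, so they are
  constants with respect to the bootstrap sampling.
\<close>

section \<open>Empirical distributions and finite samples\<close>

lemma pmf_empirical_pmf:
  assumes "xs \<noteq> []"
  shows "pmf (empirical_pmf xs) p = real (count (mset xs) p) / real (length xs)"
  using assms by (simp add: empirical_pmf_def)

lemma set_empirical_pmf:
  assumes "xs \<noteq> []"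
  shows "set_pmf (empirical_pmf xs) = set xs"
  using assms by (simp add: empirical_pmf_def)

lemma expectation_empirical_pmf:
  fixes f :: "'a \<Rightarrow> real"
  assumes "xs \<noteq> []"
  shows "measure_pmf.expectation (empirical_pmf xs) f = sum_list (map f xs) / real (length xs)"
proof -
  have "measure_pmf.expectation (empirical_pmf xs) f
      = (\<Sum>a\<in>set xs. pmf (empirical_pmf xs) a *\<^sub>R f a)"
    using assms by (intro integral_measure_pmf) (auto simp: set_empirical_pmf)
  also have "\<dots> = (\<Sum>a\<in>set xs. real (count (mset xs) a) * f a) / real (length xs)"
    using assms by (simp add: pmf_empirical_pmf sum_divide_distrib)
  also have "(\<Sum>a\<in>set xs. real (count (mset xs) a) * f a) = sum_list (map f xs)"
  proof -
    have "(\<Sum>a\<in>X. real (count (mset ys) a) * f a) = sum_list (map f ys)"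
      if "finite X" "set ys \<subseteq> X" for X ys
      using that(2)
    proof (induction ys)
      case (Cons y ys)
      have "(\<Sum>a\<in>X. real (count (mset (y # ys)) a) * f a)
          = (\<Sum>a\<in>X. real (count (mset ys) a) * f a + (if a = y then f a else 0))"
        by (intro sum.cong refl) (simp add: distrib_right)
      also have "\<dots> = (\<Sum>a\<in>X. real (count (mset ys) a) * f a) + f y"
        using Cons.prems that(1) by (simp only: sum.distrib) simp
      also have "(\<Sum>a\<in>X. real (count (mset ys) a) * f a) = sum_list (map f ys)"
        using Cons by simp
      finally show ?case by simp
    qed simp
    from this[OF finite_set order_refl] show ?thesis .
  qed
  finally show ?thesis .
qed

lemma pmf_replicate_pmf:
  "pmf (replicate_pmf n p) xs = (if length xs = n then prod_list (map (pmf p) xs) else 0)"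
proof (induction n arbitrary: xs)
  case 0
  then show ?case by (auto simp: indicator_def)
next
  case (Suc n)
  show ?case
  proof (cases xs)
    case Nil
    then have "xs \<notin> set_pmf (replicate_pmf (Suc n) p)"
      by (auto simp: set_replicate_pmf)
    with Nil show ?thesis by (simp add: set_pmf_iff del: replicate_pmf.simps)
  next
    case (Cons y ys)
    have "replicate_pmf (Suc n) p
        = map_pmf (\<lambda>(x, xs). x # xs) (pair_pmf p (replicate_pmf n p))"
      by (simp add: pair_pmf_def map_pmf_def bind_assoc_pmf bind_return_pmf)
    moreover have "inj (\<lambda>(x, xs). x # xs)"
      by (auto simp: inj_def)
    ultimately have "pmf (replicate_pmf (Suc n) p) (y # ys) = pmf p y * pmf (replicate_pmf n p) ys"
      using pmf_map_inj'[of "\<lambda>(x, xs). x # xs" "pair_pmf p (replicate_pmf n p)" "(y, ys)"]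
      by (simp add: pmf_pair)
    with Cons Suc.IH show ?thesis by simp
  qed
qed

lemma finite_set_replicate_pmf:
  assumes "finite (set_pmf p)"
  shows "finite (set_pmf (replicate_pmf n p))"
proof -
  have "set_pmf (replicate_pmf n p) = {xs. set xs \<subseteq> set_pmf p \<and> length xs = n}"
    by (auto simp: set_replicate_pmf)
  then show ?thesis
    using finite_lists_length_eq[OF assms] by simp
qed

text \<open>
  Since \<open>stream_space\<close> carries the product \<open>\<sigma>\<close>-algebra, an event that depends on only the first
  \<open>n\<close> coordinates may fail to be measurable when the alphabet is uncountable. Hence measurability
  is a hypothesis; it passes to the sections of the event, on which the induction rests.
\<close>

lemma prob_stream_space_stake:
  assumes "{\<omega> \<in> space (stream_space (measure_pmf p)). Q (stake n \<omega>)}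
             \<in> sets (stream_space (measure_pmf p))"
  shows "\<P>(\<omega> in stream_space (measure_pmf p). Q (stake n \<omega>))
           = measure (measure_pmf (replicate_pmf n p)) {xs. Q xs}"
  using assms
proof (induction n arbitrary: Q)
  case 0
  interpret S: prob_space "stream_space (measure_pmf p)"
    by (rule prob_space.prob_space_stream_space) (rule measure_pmf.prob_space_axioms)
  show ?case
    using S.prob_space by (cases "Q []") simp_all
next
  case (Suc n)
  let ?M = "stream_space (measure_pmf p)"
  have sec: "{\<omega> \<in> space ?M. Q (x # stake n \<omega>)} \<in> sets ?M" for x
  proof -
    have "(\<lambda>\<omega>. x ## \<omega>) \<in> measurable ?M ?M"
      by (rule measurable_Stream) auto
    from measurable_sets[OF this Suc.prems]
    have "(\<lambda>\<omega>. x ## \<omega>) -` {\<omega> \<in> space ?M. Q (stake (Suc n) \<omega>)} \<inter> space ?M \<in> sets ?M" .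
    also have "(\<lambda>\<omega>. x ## \<omega>) -` {\<omega> \<in> space ?M. Q (stake (Suc n) \<omega>)} \<inter> space ?M
        = {\<omega> \<in> space ?M. Q (x # stake n \<omega>)}"
      by (auto simp: space_stream_space)
    finally show ?thesis .
  qed
  have "ennreal \<P>(\<omega> in ?M. Q (stake (Suc n) \<omega>))
      = (\<integral>\<^sup>+x. \<P>(\<omega> in ?M. Q (stake (Suc n) (x ## \<omega>))) \<partial>p)"
    by (rule prob_space.prob_stream_space[OF measure_pmf.prob_space_axioms Suc.prems])
  also have "\<dots> = (\<integral>\<^sup>+x. measure (replicate_pmf n p) {xs. Q (x # xs)} \<partial>p)"
    by (simp only: stake.simps stream.sel Suc.IH[OF sec])
  also have "\<dots> = ennreal (measure (replicate_pmf (Suc n) p) {xs. Q xs})"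
  proof -
    have "replicate_pmf (Suc n) p = bind_pmf p (\<lambda>x. map_pmf ((#) x) (replicate_pmf n p))"
      by (simp add: map_pmf_def)
    then have "emeasure (replicate_pmf (Suc n) p) {xs. Q xs}
        = (\<integral>\<^sup>+x. emeasure (replicate_pmf n p) {xs. Q (x # xs)} \<partial>p)"
      by (simp only: emeasure_bind_pmf emeasure_map_pmf vimage_Collect_eq)
    then show ?thesis
      by (simp only: measure_pmf.emeasure_eq_measure)
  qed
  finally show ?case
    by (simp only: ennreal_inj[OF measure_nonneg measure_nonneg])
qed

section \<open>The sharp upper bound in Sanov's theorem\<close>

text \<open>
  Averaging the empirical distributions over \<open>A\<close> makes the bound hold for every event \<open>A\<close>. Convexity
  enters only when the average has to lie in the same set as the empirical distributions themselves.
\<close>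

lemma prob_replicate_pmf_le_exp_KL:
  fixes P :: "'a pmf"
  assumes fin: "finite (set_pmf P)" and n: "n \<ge> 1"
    and ne: "set_pmf (replicate_pmf n P) \<inter> A \<noteq> {}"
  defines "C \<equiv> cond_pmf (replicate_pmf n P) A"
  defines "D \<equiv> bind_pmf C empirical_pmf"
  shows "measure (replicate_pmf n P) A
           \<le> exp (- (real n * measure_pmf.expectation D (\<lambda>p. ln (pmf D p / pmf P p))))"
proof -
  define g where "g p = ln (pmf D p / pmf P p)" for p
  define T where "T = set_pmf (replicate_pmf n P) \<inter> A"
  let ?q = "measure (replicate_pmf n P) A"
  have finT: "finite T"
    using finite_set_replicate_pmf[OF fin] by (simp add: T_def)
  have setC: "set_pmf C = T"
    unfolding C_def T_def using ne by simp
  have T: "length xs = n" "xs \<noteq> []" "set xs \<subseteq> set_pmf P" if "xs \<in> T" for xs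
    using that n by (auto simp: T_def set_replicate_pmf)
  have q0: "?q > 0"
    using ne by (auto intro: measure_pmf_posI)
  have E_C: "measure_pmf.expectation C f = (\<Sum>xs\<in>T. pmf C xs * f xs)" for f :: "_ \<Rightarrow> real"
    using integral_measure_pmf[of T C f] finT setC by simp
  have intC: "integrable (measure_pmf C) f" for f :: "_ \<Rightarrow> real"
    using finT setC by (intro integrable_measure_pmf_finite) simp
  have E_D: "measure_pmf.expectation C (\<lambda>xs. sum_list (map g xs)) = real n * measure_pmf.expectation D g"
  proof -
    have "measure_pmf.expectation D g
        = (\<Sum>xs\<in>T. pmf C xs *\<^sub>R measure_pmf.expectation (empirical_pmf xs) g)"
      unfolding D_def using finT setC T by (intro pmf_expectation_bind) (auto simp: set_empirical_pmf)
    also have "\<dots> = (\<Sum>xs\<in>T. pmf C xs * (sum_list (map g xs) / real n))"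
      using T by (intro sum.cong) (auto simp: expectation_empirical_pmf)
    finally show ?thesis
      using n by (simp add: E_C sum_distrib_left)
  qed
  \<comment> \<open>The logarithm is a genuine one here: a point that occurs in a sample from \<open>T\<close> is charged by
      both \<open>D\<close> and \<open>P\<close>.\<close>
  have exp_g: "pmf P p * exp (g p) = pmf D p" if "xs \<in> T" "p \<in> set xs" for xs p
  proof -
    have "p \<in> set_pmf D"
      unfolding D_def using that setC T(2)[OF that(1)] by (auto simp: set_empirical_pmf intro!: bexI[of _ xs])
    then have "pmf D p > 0" "pmf P p > 0"
      using that T(3)[OF that(1)] by (auto intro: pmf_positive)
    then show ?thesis by (simp add: g_def)
  qed
  \<comment> \<open>The change of measure from \<open>P\<^sup>n\<close> to \<open>D\<^sup>n\<close> on a single sample.\<close>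
  have prod: "?q * pmf C xs * exp (sum_list (map g xs)) = pmf (replicate_pmf n D) xs"
    if xs: "xs \<in> T" for xs
  proof -
    have "?q * pmf C xs = pmf (replicate_pmf n P) xs"
      using ne q0 xs by (simp add: C_def pmf_cond T_def)
    moreover have "prod_list (map (pmf P) ys) * exp (sum_list (map g ys)) = prod_list (map (pmf D) ys)"
      if "set ys \<subseteq> set xs" for ys
      using that
    proof (induction ys)
      case (Cons y ys)
      have "prod_list (map (pmf P) (y # ys)) * exp (sum_list (map g (y # ys)))
          = (pmf P y * exp (g y)) * (prod_list (map (pmf P) ys) * exp (sum_list (map g ys)))"
        by (simp add: exp_add)
      also have "\<dots> = pmf D y * prod_list (map (pmf D) ys)"
        using Cons exp_g[OF xs] by simp
      finally show ?case by simp
    qed simp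
    ultimately show ?thesis
      using T(1)[OF xs] by (simp add: pmf_replicate_pmf)
  qed
  have "exp (real n * measure_pmf.expectation D g)
      \<le> measure_pmf.expectation C (\<lambda>xs. exp (sum_list (map g xs)))"
    unfolding E_D[symmetric]
    by (rule measure_pmf.jensens_inequality[where I = UNIV])
       (auto intro: intC exp_convex convex_on_subset)
  then have "?q * exp (real n * measure_pmf.expectation D g)
      \<le> ?q * measure_pmf.expectation C (\<lambda>xs. exp (sum_list (map g xs)))"
    using q0 by (simp add: mult_left_mono)
  also have "\<dots> = (\<Sum>xs\<in>T. pmf (replicate_pmf n D) xs)"
    unfolding E_C sum_distrib_left by (intro sum.cong refl) (simp add: prod mult.assoc[symmetric])
  also have "\<dots> = measure (replicate_pmf n D) T"
    using finT by (simp add: measure_measure_pmf_finite)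
  also have "\<dots> \<le> 1"
    by simp
  finally have "?q \<le> exp (- (real n * measure_pmf.expectation D g))"
    by (simp only: exp_minus inverse_eq_divide pos_le_divide_eq[OF exp_gt_zero])
  then show ?thesis
    unfolding g_def .
qed

lemma bootstrap_dist_eq_expectation:
  assumes "finite S" "set_pmf D \<subseteq> S" "set_pmf D \<subseteq> set_pmf P"
  shows "bootstrap_dist S D P = ereal (measure_pmf.expectation D (\<lambda>p. ln (pmf D p / pmf P p)))"
proof -
  have "bootstrap_dist S D P = (\<Sum>p\<in>S. ereal (pmf D p * ln (pmf D p / pmf P p)))"
    unfolding bootstrap_dist_def using assms by (intro sum.cong) (auto simp: set_pmf_iff)
  also have "\<dots> = ereal (\<Sum>p\<in>S. pmf D p * ln (pmf D p / pmf P p))"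
    by simp
  finally show ?thesis
    using assms by (subst integral_measure_pmf[of S]) auto
qed

section \<open>Superlevel sets of the Nadaraya--Watson estimator\<close>

text \<open>
  Clearing the positive denominator turns the comparison with \<open>c\<close> into the sign of an expectation,
  which is linear in the distribution.
\<close>

lemma less_nadaraya_watson_iff:
  fixes S :: "('x \<times> 'y) set"
  assumes fin: "finite S" and D: "set_pmf D \<subseteq> S"
    and w: "\<And>x. w x x0 > 0"
    and L: "\<And>x y. (x, y) \<in> S \<Longrightarrow> L z y < \<infinity>"
    and c: "c \<ge> 0"
  shows "ennreal c < nadaraya_watson S w L x0 D z \<longleftrightarrow>
         0 < measure_pmf.expectation D (\<lambda>(x, y). w x x0 * (enn2real (L z y) - c))"
proof -
  define N where "N = (\<Sum>(x, y)\<in>S. enn2real (L z y) * w x x0 * pmf D (x, y))"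
  define W where "W = (\<Sum>(x, y)\<in>S. w x x0 * pmf D (x, y))"
  have "(\<Sum>(x, y)\<in>S. L z y * ennreal (w x x0) * ennreal (pmf D (x, y)))
      = (\<Sum>p\<in>S. ennreal ((case p of (x, y) \<Rightarrow> enn2real (L z y) * w x x0 * pmf D (x, y))))"
    using L w by (intro sum.cong refl) (auto simp: ennreal_mult less_imp_le)
  also have "\<dots> = ennreal N"
    unfolding N_def using w by (intro sum_ennreal) (auto simp: less_imp_le)
  finally have num: "(\<Sum>(x, y)\<in>S. L z y * ennreal (w x x0) * ennreal (pmf D (x, y))) = ennreal N" .
  have "(\<Sum>(x, y)\<in>S. ennreal (w x x0) * ennreal (pmf D (x, y)))
      = (\<Sum>p\<in>S. ennreal (case p of (x, y) \<Rightarrow> w x x0 * pmf D (x, y)))"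
    using w by (intro sum.cong refl) (auto simp: ennreal_mult less_imp_le)
  also have "\<dots> = ennreal W"
    unfolding W_def using w by (intro sum_ennreal) (auto simp: less_imp_le)
  finally have den: "(\<Sum>(x, y)\<in>S. ennreal (w x x0) * ennreal (pmf D (x, y))) = ennreal W" .
  have N0: "N \<ge> 0"
    unfolding N_def using w by (intro sum_nonneg) (auto simp: less_imp_le)
  obtain x1 y1 where p1: "(x1, y1) \<in> set_pmf D"
    using set_pmf_not_empty[of D] by (metis all_not_in_conv surj_pair)
  have "W > 0"
    unfolding W_def
  proof (rule sum_pos2[OF fin])
    show "(x1, y1) \<in> S" using p1 D by auto
  qed (use w p1 in \<open>auto simp: pmf_positive less_imp_le\<close>)
  then have "ennreal c < nadaraya_watson S w L x0 D z \<longleftrightarrow> c < N / W"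
    using N0 c by (simp add: nadaraya_watson_def num den divide_ennreal ennreal_less_iff)
  also have "\<dots> \<longleftrightarrow> 0 < N - c * W"
    using \<open>W > 0\<close> by (simp add: field_simps)
  also have "N - c * W = (\<Sum>p\<in>S. pmf D p * (case p of (x, y) \<Rightarrow> w x x0 * (enn2real (L z y) - c)))"
    unfolding N_def W_def sum_distrib_left sum_subtractf[symmetric]
    by (intro sum.cong refl) (auto simp: algebra_simps)
  also have "\<dots> = measure_pmf.expectation D (\<lambda>(x, y). w x x0 * (enn2real (L z y) - c))"
    using fin D by (subst integral_measure_pmf[of S]) auto
  finally show ?thesis .
qed

text \<open>
  Convexity of the superlevel set, in the form used below: \<open>bind_pmf C D\<close> is the mixture of the
  distributions \<open>D i\<close> with mixing weights \<open>C\<close>, and a mixture of positive expectations is positive.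
\<close>

lemma less_nadaraya_watson_bind_pmf:
  fixes S :: "('x \<times> 'y) set"
  assumes fin: "finite S" and finC: "finite (set_pmf C)"
    and D: "\<And>i. i \<in> set_pmf C \<Longrightarrow> set_pmf (D i) \<subseteq> S"
    and w: "\<And>x. w x x0 > 0"
    and L: "\<And>x y. (x, y) \<in> S \<Longrightarrow> L z y < \<infinity>"
    and c: "c \<ge> 0"
    and gt: "\<And>i. i \<in> set_pmf C \<Longrightarrow> ennreal c < nadaraya_watson S w L x0 (D i) z"
  shows "ennreal c < nadaraya_watson S w L x0 (bind_pmf C D) z"
proof -
  let ?f = "\<lambda>(x, y). w x x0 * (enn2real (L z y) - c)"
  have iff: "ennreal c < nadaraya_watson S w L x0 D' z \<longleftrightarrow> 0 < measure_pmf.expectation D' ?f"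
    if "set_pmf D' \<subseteq> S" for D'
    by (rule less_nadaraya_watson_iff) (use that fin w L c in auto)
  have "measure_pmf.expectation (bind_pmf C D) ?f
      = (\<Sum>i\<in>set_pmf C. pmf C i *\<^sub>R measure_pmf.expectation (D i) ?f)"
    using fin finC D by (intro pmf_expectation_bind) (auto intro: finite_subset)
  also have "\<dots> > 0"
    using finC gt iff[OF D] by (intro sum_pos) (auto simp: set_pmf_not_empty pmf_positive)
  finally show ?thesis
    using D by (subst iff) auto
qed

lemma nadaraya_watson_eq_top:
  assumes fin: "finite S" and p: "(x1, y1) \<in> set_pmf D" "(x1, y1) \<in> S"
    and w: "w x1 x0 > 0" and L: "L z y1 = \<infinity>"
  shows "nadaraya_watson S w L x0 D z = \<infinity>"
proof -
  have "(\<Sum>(x, y)\<in>S. ennreal (w x x0) * ennreal (pmf D (x, y))) < top"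
    using fin by (simp add: ennreal_mult_less_top case_prod_beta less_top)
  moreover have "L z y1 * ennreal (w x1 x0) * ennreal (pmf D (x1, y1)) = \<infinity>"
    using p w L by (simp add: ennreal_top_mult pmf_positive_iff set_pmf_iff)
  then have "(\<Sum>(x, y)\<in>S. L z y * ennreal (w x x0) * ennreal (pmf D (x, y))) = \<infinity>"
    using fin p by (auto intro!: bexI[of _ "(x1, y1)"])
  ultimately show ?thesis
    by (simp add: nadaraya_watson_def ennreal_top_divide)
qed

text \<open>
  The estimate depends on the sample only through the number of occurrences of each point of \<open>S\<close>,
  and such a count is a finite sum of indicators of single coordinates. This is what makes the
  disappointment event measurable even though \<open>stake n\<close> need not be a measurable map.
\<close>

lemma borel_measurable_nadaraya_watson_stake:
  fixes p :: "('x \<times> 'y) pmf"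
  assumes "n \<ge> 1"
  shows "(\<lambda>\<omega>. nadaraya_watson S w L x0 (empirical_pmf (stake n \<omega>)) z)
           \<in> borel_measurable (stream_space (measure_pmf p))"
proof -
  have count: "(\<lambda>\<omega>. real (count (mset (stake n \<omega>)) a)) \<in> borel_measurable (stream_space (measure_pmf p))" for a
  proof (induction n)
    case (Suc n)
    have "(\<lambda>\<omega>. real (count (mset (stake (Suc n) \<omega>)) a))
        = (\<lambda>\<omega>. indicator {a} (shd \<omega>) + real (count (mset (stake n (stl \<omega>))) a))"
      by (auto simp: fun_eq_iff indicator_def)
    moreover have "(\<lambda>\<omega>. indicator {a} (shd \<omega>) :: real) \<in> borel_measurable (stream_space (measure_pmf p))"
      by (rule measurable_compose[OF measurable_shd]) simp
    ultimately show ?case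
      using measurable_compose[OF measurable_stl Suc.IH] by simp
  qed simp
  have [measurable]: "(\<lambda>\<omega>. pmf (empirical_pmf (stake n \<omega>)) a)
      \<in> borel_measurable (stream_space (measure_pmf p))" for a
  proof -
    have "stake n \<omega> \<noteq> []" for \<omega> :: "('x \<times> 'y) stream"
      using assms by (metis length_stake list.size(3) not_one_le_zero)
    with count show ?thesis by (simp add: pmf_empirical_pmf borel_measurable_divide)
  qed
  show ?thesis
    unfolding nadaraya_watson_def case_prod_beta by measurable
qed

section \<open>Bootstrap disappointment\<close>

theorem corollary2:
  fixes ds :: "((real ^ 'p) \<times> (real ^ 'q)) list"
    and \<Omega> :: "((real ^ 'p) \<times> (real ^ 'q)) set"
    and n :: nat
    and w :: "nat \<Rightarrow> real ^ 'p \<Rightarrow> real ^ 'p \<Rightarrow> real"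
    and L :: "real ^ 'd \<Rightarrow> real ^ 'q \<Rightarrow> ennreal"
    and x0 :: "real ^ 'p"
    and r :: real
    and zr :: "real ^ 'd"
  assumes "length ds = n" and "n \<ge> 1" and "set ds \<subseteq> \<Omega>"
    and "\<And>x x'. w n x x' > 0"
    and "\<And>y. convex_ennreal (\<lambda>z. L z y)"
    and "\<And>z. L z \<in> borel_measurable borel"
    and "r \<ge> 0"
    and "is_arg_min (robust_nadaraya_watson (set ds) (w n) L r x0 (empirical_pmf ds))
           (\<lambda>_. True) zr"
  shows "\<P>(\<omega> in stream_space (measure_pmf (empirical_pmf ds)).
            nadaraya_watson (set ds) (w n) L x0 (empirical_pmf (stake n \<omega>)) zr
              > robust_nadaraya_watson (set ds) (w n) L r x0 (empirical_pmf ds) zr)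
         \<le> exp (- (real n * r))"
proof -
  define S where "S = set ds"
  define P where "P = empirical_pmf ds"
  define c where "c = robust_nadaraya_watson S (w n) L r x0 P zr"
  define A where "A = {xs. c < nadaraya_watson S (w n) L x0 (empirical_pmf xs) zr}"
  let ?NW = "\<lambda>D. nadaraya_watson S (w n) L x0 D zr"
  have finS: "finite S"
    by (simp add: S_def)
  have setP: "set_pmf P = S"
    unfolding P_def S_def using assms(1,2) by (intro set_empirical_pmf) auto
  have le_c: "?NW D \<le> c" if "set_pmf D \<subseteq> S" "bootstrap_dist S D P \<le> ereal r" for D
    unfolding c_def robust_nadaraya_watson_def
    by (rule SUP_upper) (use that in \<open>auto simp: dists_on_def\<close>)
  have "measure (replicate_pmf n P) A \<le> exp (- (real n * r))"
  proof (cases "c < \<infinity> \<and> set_pmf (replicate_pmf n P) \<inter> A \<noteq> {}")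
    case False
    then have "measure (replicate_pmf n P) A = 0"
      by (auto simp: measure_pmf_zero_iff A_def less_top[symmetric])
    then show ?thesis by simp
  next
    case True
    then obtain c' where c': "c = ennreal c'" "c' \<ge> 0"
      by (cases c) auto
    have "bootstrap_dist S P P = 0"
      using setP by (auto simp: bootstrap_dist_def intro!: sum.neutral)
    then have "?NW P \<le> c"
      using le_c[of P] setP assms(7) by simp
    have L_fin: "L zr y < \<infinity>" if "(x, y) \<in> S" for x y
    proof (rule ccontr)
      assume "\<not> L zr y < \<infinity>"
      then have "L zr y = \<infinity>"
        by (metis infinity_ennreal_def less_top)
      then have "?NW P = \<infinity>"
        using that setP assms(4) by (intro nadaraya_watson_eq_top[OF finS, of x y]) auto
      with \<open>?NW P \<le> c\<close> True show False
        by (auto simp: top_unique)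
    qed
    define C where "C = cond_pmf (replicate_pmf n P) A"
    define D where "D = bind_pmf C empirical_pmf"
    have setC: "set_pmf C = set_pmf (replicate_pmf n P) \<inter> A"
      unfolding C_def using True by simp
    have emp: "set_pmf (empirical_pmf xs) \<subseteq> S" if "xs \<in> set_pmf C" for xs
      using that assms(2) setP
      by (subst set_empirical_pmf) (auto simp: setC set_replicate_pmf)
    then have setD: "set_pmf D \<subseteq> S"
      by (auto simp: D_def)
    have "c < ?NW D"
      unfolding D_def c'(1)
    proof (rule less_nadaraya_watson_bind_pmf)
      show "finite (set_pmf C)"
        using finite_set_replicate_pmf[of P n] finS setP by (simp add: setC)
      show "ennreal c' < ?NW (empirical_pmf xs)" if "xs \<in> set_pmf C" for xs
        using that by (simp add: setC A_def c')
    qed (use finS emp assms(4) L_fin c' in auto)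
    then have "ereal r < bootstrap_dist S D P"
      using le_c[OF setD] by (meson not_le)
    then have "r < measure_pmf.expectation D (\<lambda>p. ln (pmf D p / pmf P p))"
      using bootstrap_dist_eq_expectation[OF finS setD] setD setP by simp
    moreover have "measure (replicate_pmf n P) A
        \<le> exp (- (real n * measure_pmf.expectation D (\<lambda>p. ln (pmf D p / pmf P p))))"
      unfolding D_def C_def
      using True assms(2) finS setP by (intro prob_replicate_pmf_le_exp_KL) auto
    moreover have "exp (- (real n * measure_pmf.expectation D (\<lambda>p. ln (pmf D p / pmf P p))))
        \<le> exp (- (real n * r))"
      using calculation(1) by (simp add: mult_left_mono)
    ultimately show ?thesis by linarith
  qed
  moreover have "\<P>(\<omega> in stream_space (measure_pmf P). c < ?NW (empirical_pmf (stake n \<omega>)))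
      = measure (replicate_pmf n P) A"
    unfolding A_def
    using borel_measurable_nadaraya_watson_stake[OF assms(2), of S "w n" L x0 zr P]
    by (intro prob_stream_space_stake[where Q = "\<lambda>xs. c < ?NW (empirical_pmf xs)"]) simp
  ultimately show ?thesis
    by (simp add: c_def P_def S_def)
qed

end
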